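(* Let $f\colon M\to S^4$ be an immersion of a discrete surface $M$ with regular combinatorics and let $f^\sharp,f^\flat\colon M'\to S^4$ be two immersed Darboux transforms of $f$ with $f^\sharp(b)\ne f^\flat(b)$ for all $b\in M'$. Then there is a map $\tilde f\colon M''\to S^4$ that simultaneously is a Darboux transform of $f^\sharp$ and of $f^\flat$.
   Context: A discrete surface $M$ is the vertex set $\mathcal V$ of a triangulation of an oriented smooth surface whose faces are decomposed into black triangles $\mathcal B$ and white triangles $\mathcal W$ such that triangles of the same color never share an edge. The triangulation is a regular cellular decomposition (the three vertices and edges of a triangle are distinct), not necessarily simplicial. $M$ has regular combinatorics if every vertex has valence six. $M'$ is the cellular decomposition of the same surface with vertex set $\mathcal B$, "black" faces $\mathcal W$ and "white" faces $\mathcal V$: its edges correspond to pairs $(w,v)$, $v$ a vertex of $w\in\mathcal W$, and the edge $(w,v)$ joins the two black triangles adjacent to $w$ along the two edges of $w$ incident to $v$. Thus the vertices of the face $w\in\mathcal W$ of $M'$ are the black triangles adjacent to $w$, and the vertices of the face $v\in\mathcal V$ of $M'$ are the black triangles containing $v$. $M''$ is obtained by applying the same construction to $M'$, so $M''$ has vertex set $\mathcal W$, "black" faces $\mathcal V$ and "white" faces $\mathcal B$. If $M$ has regular combinatorics then $M'$ and $M''$ are again discrete surfaces (bi-colored triangulations) with regular combinatorics. A map $f\colon M\to S^4=\mathbb{H}\mathbb{P}^1$ is identified with the line subbundle $L$, $L_p=f(p)\subset\mathbb{H}^2$ (right quaternionic lines), of the trivial $\mathbb{H}^2$-bundle $V$;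 it is an immersion (immersed) if $f(p)\ne f(q)$ for adjacent vertices $p,q$. A Darboux transform of an immersion $f\colon M\to S^4$ is a map $f^\sharp\colon M'\to S^4$, with line bundle $L^\sharp$, such that $L^\sharp_b\ne L_v$ for every black triangle $b$ and every vertex $v$ of $b$, and such that the connection on $L^\sharp$ defined along the edge $(w,v)$ of $M'$ joining $b_1,b_2$ by $L^\sharp_{b_1}\to\mathbb{H}^2/L_v\to L^\sharp_{b_2}$ (canonical projection followed by the inverse of the canonical projection) is flat, i.e. has trivial holonomy around every face of $M'$. The same definition is applied with $M,M'$ replaced by $M',M''$. *)

theory Defs
  imports Complex_Main "HOL-Library.Product_Plus"
begin

section \<open>Quaternions\<close>

datatype quat = Quat (q0: real) (q1: real) (q2: real) (q3: real)

lemma quat_eq_iff: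
  "x = y \<longleftrightarrow> q0 x = q0 y \<and> q1 x = q1 y \<and> q2 x = q2 y \<and> q3 x = q3 y"
  by (cases x; cases y) simp

instantiation quat :: division_ring
begin

definition zero_quat :: quat where
  "0 = Quat 0 0 0 0"

definition one_quat :: quat where
  "1 = Quat 1 0 0 0"

definition plus_quat :: "quat \<Rightarrow> quat \<Rightarrow> quat" where
  "x + y = Quat (q0 x + q0 y) (q1 x + q1 y) (q2 x + q2 y) (q3 x + q3 y)"

definition uminus_quat :: "quat \<Rightarrow> quat" where
  "- x = Quat (- q0 x) (- q1 x) (- q2 x) (- q3 x)"

definition minus_quat :: "quat \<Rightarrow> quat \<Rightarrow> quat" where
  "x - y = Quat (q0 x - q0 y) (q1 x - q1 y) (q2 x - q2 y) (q3 x - q3 y)"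

definition times_quat :: "quat \<Rightarrow> quat \<Rightarrow> quat" where
  "x * y = Quat
     (q0 x * q0 y - q1 x * q1 y - q2 x * q2 y - q3 x * q3 y)
     (q0 x * q1 y + q1 x * q0 y + q2 x * q3 y - q3 x * q2 y)
     (q0 x * q2 y - q1 x * q3 y + q2 x * q0 y + q3 x * q1 y)
     (q0 x * q3 y + q1 x * q2 y - q2 x * q1 y + q3 x * q0 y)"

definition inverse_quat :: "quat \<Rightarrow> quat" where
  "inverse x =
     (let n = (q0 x)\<^sup>2 + (q1 x)\<^sup>2 + (q2 x)\<^sup>2 + (q3 x)\<^sup>2
      in Quat (q0 x / n) (- q1 x / n) (- q2 x / n) (- q3 x / n))"

definition divide_quat :: "quat \<Rightarrow> quat \<Rightarrow> quat" where
  "x div y = x * inverse y" for x y :: quat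

lemma quat_norm_eq_0:
  "(q0 x)\<^sup>2 + (q1 x)\<^sup>2 + (q2 x)\<^sup>2 + (q3 x)\<^sup>2 = 0 \<longleftrightarrow> x = 0"
  by (cases x) (simp add: zero_quat_def add_nonneg_eq_0_iff)

instance
proof
  fix x y z :: quat
  show "x * y * z = x * (y * z)"
    by (simp add: times_quat_def algebra_simps)
  show "x \<noteq> 0 \<Longrightarrow> inverse x * x = 1"
  proof -
    define n where "n = (q0 x)\<^sup>2 + (q1 x)\<^sup>2 + (q2 x)\<^sup>2 + (q3 x)\<^sup>2"
    assume "x \<noteq> 0"
    then have "n \<noteq> 0" by (simp add: n_def quat_norm_eq_0)
    then have "q0 x * q0 x / n + q1 x * q1 x / n + q2 x * q2 x / n + q3 x * q3 x / n = 1"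
      by (simp add: n_def power2_eq_square flip: add_divide_distrib)
    then show "inverse x * x = 1"
      by (simp add: inverse_quat_def times_quat_def one_quat_def Let_def flip: n_def)
  qed
  show "x \<noteq> 0 \<Longrightarrow> x * inverse x = 1"
  proof -
    define n where "n = (q0 x)\<^sup>2 + (q1 x)\<^sup>2 + (q2 x)\<^sup>2 + (q3 x)\<^sup>2"
    assume "x \<noteq> 0"
    then have "n \<noteq> 0" by (simp add: n_def quat_norm_eq_0)
    then have "q0 x * q0 x / n + q1 x * q1 x / n + q2 x * q2 x / n + q3 x * q3 x / n = 1"
      by (simp add: n_def power2_eq_square flip: add_divide_distrib)
    then show "x * inverse x = 1"
      by (simp add: inverse_quat_def times_quat_def one_quat_def Let_def flip: n_def)
  qed
  show "inverse (0::quat) = 0"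
    by (simp add: inverse_quat_def zero_quat_def)
qed (simp_all add: zero_quat_def one_quat_def plus_quat_def uminus_quat_def minus_quat_def
       times_quat_def divide_quat_def quat_eq_iff algebra_simps)

end


section \<open>The quaternionic projective line\<close>

type_synonym quat2 = "quat \<times> quat"

text \<open>Scalars act from the right.\<close>

definition quat_line :: "quat2 \<Rightarrow> quat2 set" where
  "quat_line \<psi> = {(fst \<psi> * c, snd \<psi> * c) | c. True}"

definition HP1 :: "quat2 set set" where
  "HP1 = {quat_line \<psi> | \<psi>. \<psi> \<noteq> 0}"

text \<open>The canonical projection to the quotient by \<open>L\<close>, whose elements are the cosets of \<open>L\<close>.\<close>

definition quot_proj :: "quat2 set \<Rightarrow> quat2 \<Rightarrow> quat2 set" where
  "quot_proj L \<psi> = (\<lambda>x. \<psi> + x) ` L"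

text \<open>The map \<open>K\<^sub>1 \<rightarrow> quotient by L \<rightarrow> K\<^sub>2\<close>; as a map on \<open>K\<^sub>1\<close> it depends only on \<open>L\<close> and \<open>K\<^sub>2\<close>.
  On \<open>HP1\<close> the inverse exists when \<open>K\<^sub>2 \<noteq> L\<close>.\<close>

definition line_transport :: "quat2 set \<Rightarrow> quat2 set \<Rightarrow> quat2 \<Rightarrow> quat2" where
  "line_transport L K\<^sub>2 \<psi> = the_inv_into K\<^sub>2 (quot_proj L) (quot_proj L \<psi>)"


section \<open>Discrete surfaces\<close>

text \<open>
  Oriented cellular decompositions with bi-colored faces are encoded combinatorially. Every edge
  lies on exactly one black and one white face; it is directed from \<open>tail\<close> to \<open>head\<close> so that its
  black face is on its left. Hence the boundary of a black face is traversed positively, and that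
  of a white face negatively, in the direction of the edges. Edges are separate objects, not pairs
  of vertices, because different edges may have the same end points, and likewise different
  triangles the same vertices.
\<close>

record ('v, 'b, 'w, 'e) bicolored =
  vertices :: "'v set"
  blacks :: "'b set"
  whites :: "'w set"
  edges :: "'e set"
  tail :: "'e \<Rightarrow> 'v"
  head :: "'e \<Rightarrow> 'v"
  black :: "'e \<Rightarrow> 'b"
  white :: "'e \<Rightarrow> 'w"

definition black_edges :: "('v, 'b, 'w, 'e) bicolored \<Rightarrow> 'b \<Rightarrow> 'e set" where
  "black_edges M b = {e \<in> edges M. black M e = b}"

definition white_edges :: "('v, 'b, 'w, 'e) bicolored \<Rightarrow> 'w \<Rightarrow> 'e set" where
  "white_edges M w = {e \<in> edges M. white M e = w}"

definition edges_at :: "('v, 'b, 'w, 'e) bicolored \<Rightarrow> 'v \<Rightarrow> 'e set" where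
  "edges_at M v = {e \<in> edges M. tail M e = v \<or> head M e = v}"

definition black_vertices :: "('v, 'b, 'w, 'e) bicolored \<Rightarrow> 'b \<Rightarrow> 'v set" where
  "black_vertices M b = tail M ` black_edges M b \<union> head M ` black_edges M b"

definition white_vertices :: "('v, 'b, 'w, 'e) bicolored \<Rightarrow> 'w \<Rightarrow> 'v set" where
  "white_vertices M w = tail M ` white_edges M w \<union> head M ` white_edges M w"

text \<open>\<open>es\<close> lists the edges \<open>S\<close> of a face in the order in which its boundary is traversed.\<close>

definition boundary_cycle :: "('v, 'b, 'w, 'e) bicolored \<Rightarrow> 'e set \<Rightarrow> 'e list \<Rightarrow> bool" where
  "boundary_cycle M S es \<longleftrightarrow>
     es \<noteq> [] \<and> distinct es \<and> set es = S \<and>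
     (\<forall>i<length es. head M (es ! i) = tail M (es ! (Suc i mod length es)))"

definition triangle :: "('v, 'b, 'w, 'e) bicolored \<Rightarrow> 'e set \<Rightarrow> bool" where
  "triangle M S \<longleftrightarrow>
     (\<exists>es. boundary_cycle M S es \<and> length es = 3 \<and> distinct (map (tail M) es))"

text \<open>
  The faces around \<open>v\<close> form one closed cycle, i.e. \<open>v\<close> has a disk neighborhood. In positive order
  one meets the outgoing edge \<open>outs ! i\<close>, the black face to its left, the incoming edge
  \<open>ins ! i\<close>, the white face to the right of the latter, the next outgoing edge, and so on.
\<close>

definition vertex_star ::
  "('v, 'b, 'w, 'e) bicolored \<Rightarrow> 'v \<Rightarrow> 'e list \<Rightarrow> 'e list \<Rightarrow> bool" where
  "vertex_star M v outs ins \<longleftrightarrow>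
     outs \<noteq> [] \<and> length ins = length outs \<and> distinct outs \<and> distinct ins \<and>
     set outs = {e \<in> edges M. tail M e = v} \<and>
     set ins = {e \<in> edges M. head M e = v} \<and>
     (\<forall>i<length outs.
        black M (outs ! i) = black M (ins ! i) \<and>
        white M (ins ! i) = white M (outs ! (Suc i mod length outs)))"

definition discrete_surface :: "('v, 'b, 'w, 'e) bicolored \<Rightarrow> bool" where
  "discrete_surface M \<longleftrightarrow>
     (\<forall>e\<in>edges M. tail M e \<in> vertices M \<and> head M e \<in> vertices M \<and>
        black M e \<in> blacks M \<and> white M e \<in> whites M) \<and>
     (\<forall>b\<in>blacks M. triangle M (black_edges M b)) \<and>
     (\<forall>w\<in>whites M. triangle M (white_edges M w)) \<and>
     (\<forall>v\<in>vertices M. \<exists>outs ins. vertex_star M v outs ins)"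

definition regular_combinatorics :: "('v, 'b, 'w, 'e) bicolored \<Rightarrow> bool" where
  "regular_combinatorics M \<longleftrightarrow> (\<forall>v\<in>vertices M. card (edges_at M v) = 6)"

text \<open>
  The decomposition \<open>M'\<close>: its edges are the pairs \<open>(w, v)\<close> with \<open>v\<close> a vertex of \<open>w\<close>. The two edges
  of \<open>w\<close> incident to \<open>v\<close> are the one starting at \<open>v\<close> and the one ending at \<open>v\<close>. The edge \<open>(w, v)\<close>
  is directed from the black triangle across the former to the one across the latter; this puts
  its black face \<open>w\<close> on the left and its white face \<open>v\<close> on the right.
\<close>

definition derived :: "('v, 'b, 'w, 'e) bicolored \<Rightarrow> ('b, 'w, 'v, 'w \<times> 'v) bicolored" where
  "derived M = \<lparr>
     vertices = blacks M,
     blacks = whites M,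
     whites = vertices M,
     edges = {(w, v). w \<in> whites M \<and> v \<in> white_vertices M w},
     tail = (\<lambda>(w, v). black M (THE e. e \<in> white_edges M w \<and> tail M e = v)),
     head = (\<lambda>(w, v). black M (THE e. e \<in> white_edges M w \<and> head M e = v)),
     black = fst,
     white = snd\<rparr>"


section \<open>Immersions and Darboux transforms\<close>

definition immersion :: "('v, 'b, 'w, 'e) bicolored \<Rightarrow> ('v \<Rightarrow> quat2 set) \<Rightarrow> bool" where
  "immersion M f \<longleftrightarrow>
     f ` vertices M \<subseteq> HP1 \<and> (\<forall>e\<in>edges M. f (tail M e) \<noteq> f (head M e))"

text \<open>\<open>f\<close> is the given map on \<open>M\<close> and \<open>g\<close> the map on \<open>derived M\<close>; the second component of an edge
  \<open>(w, v)\<close> of \<open>derived M\<close> is the vertex \<open>v\<close> of \<open>M\<close> whose line is divided out.\<close>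

definition edge_transport ::
  "('v, 'b, 'w, 'e) bicolored \<Rightarrow> ('v \<Rightarrow> quat2 set) \<Rightarrow> ('b \<Rightarrow> quat2 set) \<Rightarrow> 'w \<times> 'v \<Rightarrow> quat2 \<Rightarrow> quat2"
  where
  "edge_transport M f g e = line_transport (f (snd e)) (g (head (derived M) e))"

text \<open>A boundary cycle lists the edges in their common direction, so a face whose boundary is traversed
  negatively gets the inverse holonomy, which is trivial iff the holonomy is. If the vertices of
  a face are distinct, its boundary cycle is unique up to the choice of the starting vertex.\<close>

definition trivial_holonomy ::
  "('v, 'b, 'w, 'e) bicolored \<Rightarrow> ('v \<Rightarrow> quat2 set) \<Rightarrow> ('b \<Rightarrow> quat2 set) \<Rightarrow> ('w \<times> 'v) set \<Rightarrow> bool"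
  where
  "trivial_holonomy M f g S \<longleftrightarrow>
     (\<forall>es. boundary_cycle (derived M) S es \<longrightarrow>
        (\<forall>\<psi> \<in> g (tail (derived M) (hd es)). fold (edge_transport M f g) es \<psi> = \<psi>))"

definition darboux_transform ::
  "('v, 'b, 'w, 'e) bicolored \<Rightarrow> ('v \<Rightarrow> quat2 set) \<Rightarrow> ('b \<Rightarrow> quat2 set) \<Rightarrow> bool" where
  "darboux_transform M f g \<longleftrightarrow>
     g ` vertices (derived M) \<subseteq> HP1 \<and>
     (\<forall>b\<in>blacks M. \<forall>v\<in>black_vertices M b. g b \<noteq> f v) \<and>
     (\<forall>w\<in>blacks (derived M). trivial_holonomy M f g (black_edges (derived M) w)) \<and>
     (\<forall>v\<in>whites (derived M). trivial_holonomy M f g (white_edges (derived M) v))"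

end

theory Submission
  imports Defs
begin

text \<open>
  Write \<open>g\<close> and \<open>h\<close> for the two given Darboux transforms. A section of \<open>g\<close> or \<open>h\<close> over \<open>M'\<close> is
  parallel if along every edge \<open>(w, v)\<close> its values at the two ends differ by an element of \<open>f v\<close>.
  As \<open>g\<close> and \<open>h\<close> differ at every \<open>b\<close>, each vector \<open>x\<close> splits uniquely into a \<open>g b\<close>-component and
  an \<open>h b\<close>-component. The new line at a white triangle \<open>w\<close> consists of those \<open>x\<close> whose components,
  taken at the black triangles \<open>b\<close> adjacent to \<open>w\<close>, are parallel along the edges of the face \<open>w\<close>
  of \<open>M'\<close>. In other words, a parallel section of \<open>g\<close> and one of \<open>h\<close> over this face are added that
  have opposite differences along all edges, so that the sum is constant.

  For one edge \<open>(w, v)\<close> the common difference may be any vector of the line \<open>f v\<close>, and since \<open>g\<close> and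
  \<open>h\<close> are immersed it determines both sections; hence such \<open>x\<close> form a line
  (\<open>common_line_HP1\<close>). The three edges of \<open>w\<close> give the same line: by flatness the differences
  around \<open>w\<close> sum to zero for either section, and a sum of two vectors from distinct lines
  \<open>f v\<close>, \<open>f v'\<close> determines the summands. Thus opposite differences along one edge force opposite
  differences along the others (\<open>corner_line_subset_previous\<close>, \<open>permuted_eq_corner_line\<close>).

  For flatness of the new line bundle with respect to \<open>g\<close>, let \<open>w\<close> and \<open>w'\<close> be the white triangles
  at \<open>v\<close> next to the black triangle \<open>b\<close>. Transport from \<open>w\<close> to \<open>w'\<close> changes a vector by an
  element of \<open>g b\<close> and so keeps its \<open>h b\<close>-component; passing on from \<open>b\<close> to the next black triangle
  at \<open>v\<close>, the \<open>h\<close>-component changes only by an element of \<open>f v\<close>. Around the face \<open>v\<close> of \<open>M''\<close> the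
  class of the \<open>h\<close>-component modulo \<open>f v\<close> is therefore invariant
  (\<open>corner_component_step\<close>). On each new line this class determines the vector
  (\<open>corner_component_unique\<close>), so the holonomy is trivial. Around a face \<open>b\<close> of \<open>M''\<close> only
  elements of the single line \<open>g b\<close> are added, and the holonomy is trivial as well. The construction
  is symmetric in \<open>g\<close> and \<open>h\<close>, so the same map is a Darboux transform of \<open>h\<close>.
\<close>

section \<open>Quaternionic lines in the plane\<close>

definition scale_right :: "quat2 \<Rightarrow> quat \<Rightarrow> quat2" where
  "scale_right x c = (fst x * c, snd x * c)"

lemma scale_right_add: "scale_right (x + y) c = scale_right x c + scale_right y c"
  by (simp add: scale_right_def distrib_right)

lemma scale_right_diff: "scale_right (x - y) c = scale_right x c - scale_right y c"
  by (simp add: scale_right_def left_diff_distrib)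

lemma scale_right_scale_right: "scale_right (scale_right x c) d = scale_right x (c * d)"
  by (simp add: scale_right_def mult.assoc)

lemma scale_right_add_scalar: "scale_right x (c + d) = scale_right x c + scale_right x d"
  by (simp add: scale_right_def distrib_left)

lemma scale_right_one [simp]: "scale_right x 1 = x"
  by (simp add: scale_right_def)

lemma scale_right_zero [simp]: "scale_right x 0 = 0"
  by (simp add: scale_right_def prod_eq_iff)

lemma quat_line_scale_right: "quat_line x = range (scale_right x)"
  by (auto simp: quat_line_def scale_right_def)

lemma HP1_eq_range_scale_right:
  assumes "K \<in> HP1" "x \<in> K" "x \<noteq> 0"
  shows "K = range (scale_right x)"
proof -
  obtain k where K: "K = range (scale_right k)"
    using assms(1) by (auto simp: HP1_def quat_line_scale_right)
  obtain c where c: "x = scale_right k c"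
    using assms(2) K by auto
  then have "c \<noteq> 0"
    using assms(3) by auto
  have "k = scale_right x (inverse c)"
    using \<open>c \<noteq> 0\<close> c by (simp add: scale_right_scale_right)
  then have "scale_right k d = scale_right x (inverse c * d)" for d
    by (metis scale_right_scale_right)
  moreover have "scale_right x d = scale_right k (c * d)" for d
    by (simp add: c scale_right_scale_right)
  ultimately show ?thesis
    unfolding K by (auto simp: image_iff) metis+
qed

lemma HP1_nonzero: "K \<in> HP1 \<Longrightarrow> \<exists>x\<in>K. x \<noteq> 0"
  by (auto simp: HP1_def quat_line_scale_right) (metis rangeI scale_right_one)

lemma HP1_scale_right: "K \<in> HP1 \<Longrightarrow> x \<in> K \<Longrightarrow> scale_right x c \<in> K"
  by (auto simp: HP1_def quat_line_scale_right scale_right_scale_right)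

lemma HP1_zero: "K \<in> HP1 \<Longrightarrow> 0 \<in> K"
  by (metis HP1_nonzero HP1_scale_right scale_right_zero)

lemma HP1_add: "K \<in> HP1 \<Longrightarrow> x \<in> K \<Longrightarrow> y \<in> K \<Longrightarrow> x + y \<in> K"
  by (auto simp: HP1_def quat_line_scale_right scale_right_add_scalar[symmetric])

lemma HP1_uminus: "K \<in> HP1 \<Longrightarrow> x \<in> K \<Longrightarrow> - x \<in> K"
  using HP1_scale_right[of K x "- 1"] by (simp add: scale_right_def uminus_prod_def)

lemma HP1_diff: "K \<in> HP1 \<Longrightarrow> x \<in> K \<Longrightarrow> y \<in> K \<Longrightarrow> x - y \<in> K"
  using HP1_add[of K x "- y"] by (simp add: HP1_uminus)

lemma HP1_diff_commute: "K \<in> HP1 \<Longrightarrow> x - y \<in> K \<Longrightarrow> y - x \<in> K"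
  using HP1_uminus[of K "x - y"] by simp

lemma HP1_diff_trans: "K \<in> HP1 \<Longrightarrow> x - y \<in> K \<Longrightarrow> y - z \<in> K \<Longrightarrow> x - z \<in> K"
  using HP1_add[of K "x - y" "y - z"] by simp

lemma HP1_disjoint:
  assumes "K \<in> HP1" "L \<in> HP1" "K \<noteq> L" "x \<in> K" "x \<in> L"
  shows "x = 0"
  using assms HP1_eq_range_scale_right by metis

text \<open>
  Two distinct lines span the plane. The coefficients come from elimination with respect to a nonzero
  coordinate of the first generator; as scalars act from the right, the multiplier \<open>m\<close> acts on
  coordinates from the left.
\<close>

lemma HP1_decompose:
  assumes "K \<in> HP1" "L \<in> HP1" "K \<noteq> L"
  shows "\<exists>k\<in>K. \<exists>l\<in>L. x = k + l"
proof -
  obtain u v where u: "u \<in> K" "u \<noteq> 0" and v: "v \<in> L" "v \<noteq> 0"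
    using HP1_nonzero assms by blast
  have indep: "v \<noteq> scale_right u c" for c
    using HP1_disjoint[OF assms] HP1_scale_right[OF assms(1)] u v by metis
  have "\<exists>a b. x = scale_right u a + scale_right v b"
  proof (cases "fst u = 0")
    case True
    then have "snd u \<noteq> 0"
      using u(2) by (auto simp: prod_eq_iff)
    have "fst v \<noteq> 0"
    proof
      assume "fst v = 0"
      then have "v = scale_right u (inverse (snd u) * snd v)"
        using True \<open>snd u \<noteq> 0\<close>
        by (simp add: scale_right_def prod_eq_iff mult.assoc[symmetric])
      with indep show False by blast
    qed
    define b where "b = inverse (fst v) * fst x"
    have "x = scale_right u (inverse (snd u) * (snd x - snd v * b)) + scale_right v b"
      using True \<open>snd u \<noteq> 0\<close> \<open>fst v \<noteq> 0\<close>
      by (simp add: scale_right_def prod_eq_iff b_def mult.assoc[symmetric])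
    then show ?thesis by blast
  next
    case False
    define m where "m = snd u * inverse (fst u)"
    have m: "snd u = m * fst u"
      using False by (simp add: m_def mult.assoc)
    have "snd v - m * fst v \<noteq> 0"
    proof
      assume "snd v - m * fst v = 0"
      then have "v = scale_right u (inverse (fst u) * fst v)"
        using False by (simp add: scale_right_def prod_eq_iff m_def mult.assoc[symmetric])
      with indep show False by blast
    qed
    define b where "b = inverse (snd v - m * fst v) * (snd x - m * fst x)"
    have b: "(snd v - m * fst v) * b = snd x - m * fst x"
      using \<open>snd v - m * fst v \<noteq> 0\<close> by (simp add: b_def mult.assoc[symmetric])
    define a where "a = inverse (fst u) * (fst x - fst v * b)"
    have a: "fst u * a = fst x - fst v * b"
      using False by (simp add: a_def mult.assoc[symmetric])
    have "snd u * a = snd x - snd v * b"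
      using a b by (simp add: m mult.assoc) (simp add: algebra_simps)
    then have "x = scale_right u a + scale_right v b"
      using a by (simp add: scale_right_def prod_eq_iff)
    then show ?thesis by blast
  qed
  then show ?thesis
    using HP1_scale_right[OF assms(1) u(1)] HP1_scale_right[OF assms(2) v(1)] by blast
qed

lemma HP1_decompose_unique:
  assumes "K \<in> HP1" "L \<in> HP1" "K \<noteq> L" "k \<in> K" "l \<in> L" "k' \<in> K" "l' \<in> L" "k + l = k' + l'"
  shows "k = k' \<and> l = l'"
proof -
  have "k - k' = l' - l"
    using assms(8) by (simp add: algebra_simps)
  moreover have "k - k' \<in> K" "l' - l \<in> L"
    using assms by (auto intro: HP1_diff)
  ultimately have "k - k' = 0"
    using HP1_disjoint[OF assms(1-3)] by metis
  with assms(8) show ?thesis by simp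
qed

lemma quot_proj_eq_iff:
  assumes "L \<in> HP1"
  shows "quot_proj L x = quot_proj L y \<longleftrightarrow> x - y \<in> L"
proof
  assume "quot_proj L x = quot_proj L y"
  moreover have "x \<in> quot_proj L x"
    using HP1_zero[OF assms] by (force simp: quot_proj_def)
  ultimately show "x - y \<in> L"
    by (auto simp: quot_proj_def)
next
  have sub: "quot_proj L x \<subseteq> quot_proj L y" if "x - y \<in> L" for x y
  proof
    fix z assume "z \<in> quot_proj L x"
    then obtain l where "l \<in> L" "z = x + l"
      by (auto simp: quot_proj_def)
    then have "z = y + ((x - y) + l)" "(x - y) + l \<in> L"
      using HP1_add[OF assms] that by auto
    then show "z \<in> quot_proj L y"
      unfolding quot_proj_def by blast
  qed
  assume "x - y \<in> L"
  then show "quot_proj L x = quot_proj L y"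
    using sub[of x y] sub[of y x] HP1_diff_commute[OF assms] by blast
qed

text \<open>
  The projection to the quotient by \<open>L\<close> is injective on \<open>K\<close>, so the transport picks the one
  representative of the coset of \<open>x\<close> in \<open>K\<close>.
\<close>

lemma line_transport_unique:
  assumes "L \<in> HP1" "K \<in> HP1" "K \<noteq> L" "y \<in> K" "x - y \<in> L"
  shows "line_transport L K x = y"
proof -
  have "inj_on (quot_proj L) K"
  proof (rule inj_onI)
    fix y z assume "y \<in> K" "z \<in> K" "quot_proj L y = quot_proj L z"
    then have "y - z \<in> K" "y - z \<in> L"
      using HP1_diff[OF assms(2)] quot_proj_eq_iff[OF assms(1)] by auto
    then show "y = z"
      using HP1_disjoint[OF assms(2,1,3)] eq_iff_diff_eq_0 by blast
  qed
  moreover have "quot_proj L x = quot_proj L y"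
    using assms by (simp add: quot_proj_eq_iff)
  ultimately show ?thesis
    using assms(4) by (simp add: line_transport_def the_inv_into_f_f)
qed

lemma line_transport:
  assumes "L \<in> HP1" "K \<in> HP1" "K \<noteq> L"
  shows "line_transport L K x \<in> K" "x - line_transport L K x \<in> L"
proof -
  obtain y l where "y \<in> K" "l \<in> L" "x = y + l"
    using HP1_decompose[OF assms(2,1,3)] by blast
  then have "line_transport L K x = y" "x - y = l"
    using line_transport_unique[OF assms] by simp_all
  then show "line_transport L K x \<in> K" "x - line_transport L K x \<in> L"
    using \<open>y \<in> K\<close> \<open>l \<in> L\<close> by simp_all
qed


section \<open>The common line over an edge\<close>

text \<open>
  \<open>P\<^sub>1, Q\<^sub>1\<close> and \<open>P\<^sub>2, Q\<^sub>2\<close> stand for the values of the two Darboux transforms at the ends of an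
  edge of \<open>M'\<close>, and \<open>A\<close> for the line divided out along it. In terms of parallel sections \<open>p\<close>, \<open>q\<close>
  with \<open>q\<^sub>1 - q\<^sub>2 = (p\<^sub>2 - p\<^sub>1) \<chi>\<close>, the common line is spanned by \<open>p\<^sub>1 \<chi> + q\<^sub>1 = p\<^sub>2 \<chi> + q\<^sub>2\<close>.
  This form, in which \<open>\<chi>\<close> is absorbed into \<open>p\<close>, is symmetric in \<open>P\<close> and \<open>Q\<close>.
\<close>

definition common_line ::
  "quat2 set \<Rightarrow> quat2 set \<Rightarrow> quat2 set \<Rightarrow> quat2 set \<Rightarrow> quat2 set \<Rightarrow> quat2 set" where
  "common_line A P\<^sub>1 Q\<^sub>1 P\<^sub>2 Q\<^sub>2 =
     {x. \<exists>p\<^sub>1\<in>P\<^sub>1. \<exists>q\<^sub>1\<in>Q\<^sub>1. \<exists>p\<^sub>2\<in>P\<^sub>2. \<exists>q\<^sub>2\<in>Q\<^sub>2.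
        x = p\<^sub>1 + q\<^sub>1 \<and> x = p\<^sub>2 + q\<^sub>2 \<and> p\<^sub>1 - p\<^sub>2 \<in> A \<and> q\<^sub>1 - q\<^sub>2 \<in> A}"

lemma common_line_commute: "common_line A P\<^sub>1 Q\<^sub>1 P\<^sub>2 Q\<^sub>2 = common_line A Q\<^sub>1 P\<^sub>1 Q\<^sub>2 P\<^sub>2"
proof -
  have "common_line A P\<^sub>1 Q\<^sub>1 P\<^sub>2 Q\<^sub>2 \<subseteq> common_line A Q\<^sub>1 P\<^sub>1 Q\<^sub>2 P\<^sub>2"
    for P\<^sub>1 Q\<^sub>1 P\<^sub>2 Q\<^sub>2
  proof
    fix x assume "x \<in> common_line A P\<^sub>1 Q\<^sub>1 P\<^sub>2 Q\<^sub>2"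
    then obtain p\<^sub>1 q\<^sub>1 p\<^sub>2 q\<^sub>2 where
      "p\<^sub>1 \<in> P\<^sub>1" "q\<^sub>1 \<in> Q\<^sub>1" "p\<^sub>2 \<in> P\<^sub>2" "q\<^sub>2 \<in> Q\<^sub>2" "p\<^sub>1 - p\<^sub>2 \<in> A" "q\<^sub>1 - q\<^sub>2 \<in> A"
      and "x = p\<^sub>1 + q\<^sub>1" "x = p\<^sub>2 + q\<^sub>2"
      unfolding common_line_def by blast
    moreover from this have "x = q\<^sub>1 + p\<^sub>1" "x = q\<^sub>2 + p\<^sub>2"
      by (metis add.commute)+
    ultimately show "x \<in> common_line A Q\<^sub>1 P\<^sub>1 Q\<^sub>2 P\<^sub>2"
      unfolding common_line_def by blast
  qed
  then show ?thesis by blast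
qed

lemma common_line_swap:
  assumes "A \<in> HP1"
  shows "common_line A P\<^sub>1 Q\<^sub>1 P\<^sub>2 Q\<^sub>2 = common_line A P\<^sub>2 Q\<^sub>2 P\<^sub>1 Q\<^sub>1"
  unfolding common_line_def using HP1_diff_commute[OF assms] by blast

text \<open>
  The vector \<open>x\<close> is determined by the difference \<open>p\<^sub>1 - p\<^sub>2 \<in> A\<close>: because \<open>P\<^sub>1\<close> and \<open>P\<^sub>2\<close> are
  complementary it yields \<open>p\<^sub>1\<close> and \<open>p\<^sub>2\<close>, and its negative yields \<open>q\<^sub>1\<close> and \<open>q\<^sub>2\<close> in the same way. This
  identifies the common line with \<open>A\<close>, compatibly with scalars.
\<close>

lemma common_line_HP1:
  assumes HP1: "A \<in> HP1" "P\<^sub>1 \<in> HP1" "Q\<^sub>1 \<in> HP1" "P\<^sub>2 \<in> HP1" "Q\<^sub>2 \<in> HP1"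
    and "P\<^sub>1 \<noteq> P\<^sub>2" "Q\<^sub>1 \<noteq> Q\<^sub>2" "P\<^sub>1 \<noteq> Q\<^sub>1" "A \<noteq> P\<^sub>2"
  shows "common_line A P\<^sub>1 Q\<^sub>1 P\<^sub>2 Q\<^sub>2 \<in> HP1"
proof -
  obtain a where a: "a \<in> A" "a \<noteq> 0"
    using HP1_nonzero HP1(1) by blast
  obtain p\<^sub>1 p\<^sub>2' where p': "p\<^sub>1 \<in> P\<^sub>1" "p\<^sub>2' \<in> P\<^sub>2" "a = p\<^sub>1 + p\<^sub>2'"
    using HP1_decompose[OF HP1(2,4) assms(6)] by blast
  obtain q\<^sub>1 q\<^sub>2' where q': "q\<^sub>1 \<in> Q\<^sub>1" "q\<^sub>2' \<in> Q\<^sub>2" "- a = q\<^sub>1 + q\<^sub>2'"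
    using HP1_decompose[OF HP1(3,5) assms(7)] by blast
  define p\<^sub>2 where "p\<^sub>2 = - p\<^sub>2'"
  define q\<^sub>2 where "q\<^sub>2 = - q\<^sub>2'"
  have p: "p\<^sub>2 \<in> P\<^sub>2" "p\<^sub>1 - p\<^sub>2 = a" and q: "q\<^sub>2 \<in> Q\<^sub>2" "q\<^sub>1 - q\<^sub>2 = - a"
    using p' q' HP1_uminus HP1 by (auto simp: p\<^sub>2_def q\<^sub>2_def)
  define x where "x = p\<^sub>1 + q\<^sub>1"
  have x2: "x = p\<^sub>2 + q\<^sub>2"
  proof -
    have "(p\<^sub>1 - p\<^sub>2) + (q\<^sub>1 - q\<^sub>2) = 0"
      using p q by simp
    then show ?thesis
      by (simp add: x_def algebra_simps)
  qed
  have "x \<noteq> 0"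
  proof
    assume "x = 0"
    then have "p\<^sub>1 = - q\<^sub>1"
      by (simp add: x_def eq_neg_iff_add_eq_0)
    then have "p\<^sub>1 = 0"
      using HP1_disjoint[OF HP1(2,3) assms(8)] p' q' HP1_uminus[OF HP1(3)] by metis
    then have "a = - p\<^sub>2"
      using p by simp
    then show False
      using HP1_disjoint[OF HP1(1,4) assms(9)] a p HP1_uminus[OF HP1(4)] by metis
  qed
  moreover have "common_line A P\<^sub>1 Q\<^sub>1 P\<^sub>2 Q\<^sub>2 = range (scale_right x)"
  proof (intro equalityI subsetI)
    fix y assume "y \<in> common_line A P\<^sub>1 Q\<^sub>1 P\<^sub>2 Q\<^sub>2"
    then obtain r\<^sub>1 s\<^sub>1 r\<^sub>2 s\<^sub>2 where
      rs: "r\<^sub>1 \<in> P\<^sub>1" "s\<^sub>1 \<in> Q\<^sub>1" "r\<^sub>2 \<in> P\<^sub>2" "s\<^sub>2 \<in> Q\<^sub>2" "y = r\<^sub>1 + s\<^sub>1" "y = r\<^sub>2 + s\<^sub>2" "r\<^sub>1 - r\<^sub>2 \<in> A"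
      by (auto simp: common_line_def)
    then obtain c where c: "r\<^sub>1 - r\<^sub>2 = scale_right a c"
      using HP1_eq_range_scale_right[OF HP1(1) a] by auto
    have "r\<^sub>1 + (- r\<^sub>2) = scale_right p\<^sub>1 c + (- scale_right p\<^sub>2 c)"
      using c p by (simp flip: scale_right_diff)
    then have r: "r\<^sub>1 = scale_right p\<^sub>1 c"
      using HP1_decompose_unique[OF HP1(2,4) assms(6)] HP1_uminus HP1_scale_right HP1 rs p p'
      by metis
    have "s\<^sub>1 - s\<^sub>2 = - (r\<^sub>1 - r\<^sub>2)"
      using rs(5,6) by (simp add: algebra_simps)
    also have "\<dots> = scale_right (q\<^sub>1 - q\<^sub>2) c"
      using c q by (simp add: scale_right_def uminus_prod_def)
    finally have "s\<^sub>1 + (- s\<^sub>2) = scale_right q\<^sub>1 c + (- scale_right q\<^sub>2 c)"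
      by (simp add: scale_right_diff)
    then have s: "s\<^sub>1 = scale_right q\<^sub>1 c"
      using HP1_decompose_unique[OF HP1(3,5) assms(7)] HP1_uminus HP1_scale_right HP1 rs q q'
      by metis
    show "y \<in> range (scale_right x)"
      using r s rs(5) by (simp add: x_def scale_right_add[symmetric])
  next
    fix y assume "y \<in> range (scale_right x)"
    then obtain c where c: "y = scale_right x c"
      by blast
    have "y = scale_right p\<^sub>1 c + scale_right q\<^sub>1 c" "y = scale_right p\<^sub>2 c + scale_right q\<^sub>2 c"
      using c x2 by (simp_all add: x_def scale_right_add[symmetric])
    moreover have "scale_right p\<^sub>1 c - scale_right p\<^sub>2 c \<in> A" "scale_right q\<^sub>1 c - scale_right q\<^sub>2 c \<in> A"
      using p q a HP1_uminus[OF HP1(1)] HP1_scale_right[OF HP1(1)]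
      by (simp_all flip: scale_right_diff)
    moreover have "scale_right p\<^sub>1 c \<in> P\<^sub>1" "scale_right q\<^sub>1 c \<in> Q\<^sub>1"
      "scale_right p\<^sub>2 c \<in> P\<^sub>2" "scale_right q\<^sub>2 c \<in> Q\<^sub>2"
      using p q p' q' HP1 HP1_scale_right by auto
    ultimately show "y \<in> common_line A P\<^sub>1 Q\<^sub>1 P\<^sub>2 Q\<^sub>2"
      unfolding common_line_def by blast
  qed
  ultimately show ?thesis
    unfolding HP1_def quat_line_scale_right by blast
qed

text \<open>
  If \<open>x \<in> P\<^sub>1\<close>, then its \<open>Q\<^sub>1\<close>-component vanishes, hence so does the parallel \<open>Q\<^sub>2\<close>-component, and
  \<open>x\<close> lies in \<open>P\<^sub>1\<close> and in \<open>P\<^sub>2\<close>.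
\<close>

lemma common_line_Int_end:
  assumes HP1: "A \<in> HP1" "P\<^sub>1 \<in> HP1" "Q\<^sub>1 \<in> HP1" "P\<^sub>2 \<in> HP1" "Q\<^sub>2 \<in> HP1"
    and "P\<^sub>1 \<noteq> P\<^sub>2" "A \<noteq> Q\<^sub>2"
    and "x \<in> common_line A P\<^sub>1 Q\<^sub>1 P\<^sub>2 Q\<^sub>2" "x \<in> P\<^sub>1" "P\<^sub>1 \<noteq> Q\<^sub>1"
  shows "x = 0"
proof -
  obtain p\<^sub>1 q\<^sub>1 p\<^sub>2 q\<^sub>2 where
    pq: "p\<^sub>1 \<in> P\<^sub>1" "q\<^sub>1 \<in> Q\<^sub>1" "p\<^sub>2 \<in> P\<^sub>2" "q\<^sub>2 \<in> Q\<^sub>2" "x = p\<^sub>1 + q\<^sub>1" "x = p\<^sub>2 + q\<^sub>2" "q\<^sub>1 - q\<^sub>2 \<in> A"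
    using assms(8) by (auto simp: common_line_def)
  have "x + 0 = p\<^sub>1 + q\<^sub>1"
    using pq by simp
  then have "q\<^sub>1 = 0"
    using HP1_decompose_unique[OF HP1(2,3) assms(10)] HP1_zero[OF HP1(3)] assms(9) pq by metis
  then have "q\<^sub>2 \<in> A"
    using HP1_uminus[OF HP1(1) pq(7)] by simp
  then have "q\<^sub>2 = 0"
    using HP1_disjoint[OF HP1(1,5) assms(7)] pq by blast
  then have "x \<in> P\<^sub>2"
    using pq by simp
  then show ?thesis
    using HP1_disjoint[OF HP1(2,4) assms(6)] assms(9) by blast
qed


section \<open>Combinatorics of the derived surfaces\<close>

lemma triangleE:
  assumes "triangle M S"
  obtains e\<^sub>1 e\<^sub>2 e\<^sub>3 where
    "S = {e\<^sub>1, e\<^sub>2, e\<^sub>3}"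
    "head M e\<^sub>1 = tail M e\<^sub>2" "head M e\<^sub>2 = tail M e\<^sub>3" "head M e\<^sub>3 = tail M e\<^sub>1"
    "distinct [tail M e\<^sub>1, tail M e\<^sub>2, tail M e\<^sub>3]"
proof -
  obtain es where es: "boundary_cycle M S es" "length es = 3" "distinct (map (tail M) es)"
    using assms unfolding triangle_def by blast
  then obtain e\<^sub>1 e\<^sub>2 e\<^sub>3 where [simp]: "es = [e\<^sub>1, e\<^sub>2, e\<^sub>3]"
    by (auto simp: numeral_3_eq_3 length_Suc_conv)
  have heads: "head M (es ! i) = tail M (es ! (Suc i mod 3))" if "i < 3" for i
    using es that unfolding boundary_cycle_def by simp
  show thesis
  proof (rule that)
    show "S = {e\<^sub>1, e\<^sub>2, e\<^sub>3}"
      using es(1) by (simp add: boundary_cycle_def)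
    show "head M e\<^sub>1 = tail M e\<^sub>2" "head M e\<^sub>2 = tail M e\<^sub>3" "head M e\<^sub>3 = tail M e\<^sub>1"
      using heads[of 0] heads[of 1] heads[of 2] by simp_all
    show "distinct [tail M e\<^sub>1, tail M e\<^sub>2, tail M e\<^sub>3]"
      using es(3) by simp
  qed
qed

lemma triangle_tail_inj:
  assumes "triangle M S" "e \<in> S" "e' \<in> S" "tail M e = tail M e'"
  shows "e = e'"
  using assms by (elim triangleE) auto

lemma triangle_head_inj:
  assumes "triangle M S" "e \<in> S" "e' \<in> S" "head M e = head M e'"
  shows "e = e'"
  using assms by (elim triangleE) auto

lemma triangle_head_eq_tail:
  assumes "triangle M S" "e \<in> S"
  shows "\<exists>e'\<in>S. head M e' = tail M e"
  using assms by (elim triangleE) auto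

lemma triangle_tail_eq_head:
  assumes "triangle M S" "e \<in> S"
  shows "\<exists>e'\<in>S. tail M e' = head M e"
  using assms by (elim triangleE) auto

lemma derived_simps [simp]:
  "vertices (derived M) = blacks M"
  "blacks (derived M) = whites M"
  "whites (derived M) = vertices M"
  "black (derived M) = fst"
  "white (derived M) = snd"
  by (simp_all add: derived_def)

lemma derived_edges_iff:
  "(w, v) \<in> edges (derived M) \<longleftrightarrow> w \<in> whites M \<and> v \<in> white_vertices M w"
  by (simp add: derived_def)

context
  fixes M :: "('v, 'b, 'w, 'e) bicolored"
  assumes surface: "discrete_surface M"
begin

lemma surface_edge:
  assumes "e \<in> edges M"
  shows "tail M e \<in> vertices M" "head M e \<in> vertices M" "black M e \<in> blacks M" "white M e \<in> whites M"
  using surface assms unfolding discrete_surface_def by auto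

lemma surface_black_triangle: "b \<in> blacks M \<Longrightarrow> triangle M (black_edges M b)"
  using surface unfolding discrete_surface_def by auto

lemma surface_white_triangle: "w \<in> whites M \<Longrightarrow> triangle M (white_edges M w)"
  using surface unfolding discrete_surface_def by auto

text \<open>
  The corners of white triangles are the edges of \<open>M'\<close>, and each corner \<open>(w, v)\<close> arises from exactly
  one edge of \<open>M\<close> leaving \<open>v\<close> and from exactly one entering \<open>v\<close>. This replaces the definite
  descriptions in \<^const>\<open>derived\<close> by edges of \<open>M\<close>.
\<close>

lemma derived_edge_tail:
  assumes "e \<in> edges M"
  shows "(white M e, tail M e) \<in> edges (derived M)"
    and "tail (derived M) (white M e, tail M e) = black M e"
proof -
  have e: "e \<in> white_edges M (white M e)" "white M e \<in> whites M"
    using assms surface_edge by (auto simp: white_edges_def)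
  then show "(white M e, tail M e) \<in> edges (derived M)"
    by (auto simp: derived_edges_iff white_vertices_def)
  have "(THE e'. e' \<in> white_edges M (white M e) \<and> tail M e' = tail M e) = e"
    using triangle_tail_inj[OF surface_white_triangle] e by blast
  then show "tail (derived M) (white M e, tail M e) = black M e"
    by (simp add: derived_def)
qed

lemma derived_edge_head:
  assumes "e \<in> edges M"
  shows "(white M e, head M e) \<in> edges (derived M)"
    and "head (derived M) (white M e, head M e) = black M e"
proof -
  have e: "e \<in> white_edges M (white M e)" "white M e \<in> whites M"
    using assms surface_edge by (auto simp: white_edges_def)
  then show "(white M e, head M e) \<in> edges (derived M)"
    by (auto simp: derived_edges_iff white_vertices_def)
  have "(THE e'. e' \<in> white_edges M (white M e) \<and> head M e' = head M e) = e"
    using triangle_head_inj[OF surface_white_triangle] e by blast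
  then show "head (derived M) (white M e, head M e) = black M e"
    by (simp add: derived_def)
qed

lemma derived_edgeE:
  assumes "(w, v) \<in> edges (derived M)"
  obtains e e' where
    "e \<in> edges M" "white M e = w" "tail M e = v" "tail (derived M) (w, v) = black M e"
    "e' \<in> edges M" "white M e' = w" "head M e' = v" "head (derived M) (w, v) = black M e'"
proof -
  have w: "w \<in> whites M" and v: "v \<in> white_vertices M w"
    using assms by (auto simp: derived_edges_iff)
  obtain e e' where "e \<in> white_edges M w" "tail M e = v" "e' \<in> white_edges M w" "head M e' = v"
    using v triangle_head_eq_tail[OF surface_white_triangle[OF w]]
      triangle_tail_eq_head[OF surface_white_triangle[OF w]]
    unfolding white_vertices_def by fastforce
  then show thesis
    using that[of e e'] derived_edge_tail(2)[of e] derived_edge_head(2)[of e']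
    by (auto simp: white_edges_def)
qed

text \<open>
  An edge \<open>(v, b)\<close> of \<open>M''\<close> is a corner of a black triangle of \<open>M\<close>, and its ends are the white triangles
  across the two edges of \<open>b\<close> at \<open>v\<close>. They are unique because \<open>b\<close> has only one edge leaving and one
  entering \<open>v\<close>.
\<close>

lemma derived_derived_edgeE:
  assumes "(v, b) \<in> edges (derived (derived M))"
  obtains w w' where
    "(w, v) \<in> edges (derived M)" "tail (derived M) (w, v) = b"
    "tail (derived (derived M)) (v, b) = w"
    "(w', v) \<in> edges (derived M)" "head (derived M) (w', v) = b"
    "head (derived (derived M)) (v, b) = w'"
proof -
  have v: "b \<in> white_vertices (derived M) v"
    using assms by (simp add: derived_edges_iff)
  then obtain w\<^sub>0 where w0: "(w\<^sub>0, v) \<in> edges (derived M)"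
    "b = tail (derived M) (w\<^sub>0, v) \<or> b = head (derived M) (w\<^sub>0, v)"
    by (auto simp: white_vertices_def white_edges_def)
  obtain e\<^sub>0 where e0: "e\<^sub>0 \<in> edges M" "black M e\<^sub>0 = b" "tail M e\<^sub>0 = v \<or> head M e\<^sub>0 = v"
    using derived_edgeE[OF w0(1)] w0(2) by metis
  have b: "b \<in> blacks M"
    using surface_edge e0 by auto
  have "e\<^sub>0 \<in> black_edges M b"
    using e0 by (simp add: black_edges_def)
  then obtain e e' where
    "e \<in> black_edges M b" "tail M e = v" "e' \<in> black_edges M b" "head M e' = v"
    using e0(3) triangle_head_eq_tail[OF surface_black_triangle[OF b]]
      triangle_tail_eq_head[OF surface_black_triangle[OF b]] by metis
  then have e: "e \<in> edges M" "tail M e = v" "black M e = b"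
    and e': "e' \<in> edges M" "head M e' = v" "black M e' = b"
    by (auto simp: black_edges_def)
  have t: "(THE d. d \<in> white_edges (derived M) v \<and> tail (derived M) d = b) = (white M e, v)"
  proof (rule the_equality)
    show "(white M e, v) \<in> white_edges (derived M) v \<and> tail (derived M) (white M e, v) = b"
      using derived_edge_tail[OF e(1)] e by (simp add: white_edges_def)
  next
    fix d assume d: "d \<in> white_edges (derived M) v \<and> tail (derived M) d = b"
    then obtain w where w: "d = (w, v)" "(w, v) \<in> edges (derived M)"
      by (cases d) (auto simp: white_edges_def)
    from w(2) obtain e\<^sub>1 where "e\<^sub>1 \<in> edges M" "white M e\<^sub>1 = w" "tail M e\<^sub>1 = v" "black M e\<^sub>1 = b"
      using derived_edgeE d w(1) by metis
    then show "d = (white M e, v)"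
      using triangle_tail_inj[OF surface_black_triangle[OF b], of e e\<^sub>1] e w
      by (auto simp: black_edges_def)
  qed
  have h: "(THE d. d \<in> white_edges (derived M) v \<and> head (derived M) d = b) = (white M e', v)"
  proof (rule the_equality)
    show "(white M e', v) \<in> white_edges (derived M) v \<and> head (derived M) (white M e', v) = b"
      using derived_edge_head[OF e'(1)] e' by (simp add: white_edges_def)
  next
    fix d assume d: "d \<in> white_edges (derived M) v \<and> head (derived M) d = b"
    then obtain w where w: "d = (w, v)" "(w, v) \<in> edges (derived M)"
      by (cases d) (auto simp: white_edges_def)
    from w(2) obtain e\<^sub>1 where "e\<^sub>1 \<in> edges M" "white M e\<^sub>1 = w" "head M e\<^sub>1 = v" "black M e\<^sub>1 = b"
      using derived_edgeE d w(1) by metis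
    then show "d = (white M e', v)"
      using triangle_head_inj[OF surface_black_triangle[OF b], of e' e\<^sub>1] e' w
      by (auto simp: black_edges_def)
  qed
  have "tail (derived (derived M)) (v, b) = white M e" "head (derived (derived M)) (v, b) = white M e'"
    using t h by (simp_all add: derived_def[of "derived M"])
  then show thesis
    using that derived_edge_tail[OF e(1)] derived_edge_head[OF e'(1)] e e' by simp
qed

end

text \<open>
  Trivial holonomy is proved below by an invariant \<open>I\<close> of the transport that determines the vector in
  its line.
\<close>

lemma holonomy_invariant:
  assumes "boundary_cycle N S es"
    and step: "\<And>e x. e \<in> S \<Longrightarrow> I (tail N e) x \<Longrightarrow> I (head N e) (T e x)"
    and "I (tail N (hd es)) x"
  shows "I (tail N (hd es)) (fold T es x)"
proof -
  have es: "es \<noteq> []" "set es = S"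
    "\<And>i. i < length es \<Longrightarrow> head N (es ! i) = tail N (es ! (Suc i mod length es))"
    using assms(1) unfolding boundary_cycle_def by auto
  have "n \<le> length es \<Longrightarrow> I (tail N (es ! (n mod length es))) (fold T (take n es) x)" for n
  proof (induction n)
    case 0
    then show ?case using assms(3) es(1) by (simp add: hd_conv_nth)
  next
    case (Suc n)
    then have "n < length es" by simp
    then have "I (head N (es ! n)) (T (es ! n) (fold T (take n es) x))"
      using Suc step[of "es ! n"] es(2) by (metis Suc_leD mod_less nth_mem)
    then show ?case
      using \<open>n < length es\<close> es(3)[of n] by (simp add: take_Suc_conv_app_nth)
  qed
  from this[of "length es"] show ?thesis
    using es(1) by (simp add: hd_conv_nth)
qed


section \<open>The common Darboux transform\<close>

locale darboux_pair =
  fixes M :: "('v, 'b, 'w, 'e) bicolored"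
    and f :: "'v \<Rightarrow> quat2 set"
    and g h :: "'b \<Rightarrow> quat2 set"
  assumes surface: "discrete_surface M"
    and immersed: "immersion M f"
    and darboux_g: "darboux_transform M f g"
    and darboux_h: "darboux_transform M f h"
    and immersed_g: "immersion (derived M) g"
    and immersed_h: "immersion (derived M) h"
    and g_neq_h: "b \<in> blacks M \<Longrightarrow> g b \<noteq> h b"
begin

definition corner_line :: "'w \<times> 'v \<Rightarrow> quat2 set" where
  "corner_line e = common_line (f (snd e))
     (g (tail (derived M) e)) (h (tail (derived M) e))
     (g (head (derived M) e)) (h (head (derived M) e))"

text \<open>
  All corners of \<open>w\<close> give the same line; the intersection merely avoids choosing one.
\<close>

definition permuted :: "'w \<Rightarrow> quat2 set" where
  "permuted w = (\<Inter>v\<in>white_vertices M w. corner_line (w, v))"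

lemma lines:
  shows "v \<in> vertices M \<Longrightarrow> f v \<in> HP1"
    and "b \<in> blacks M \<Longrightarrow> g b \<in> HP1"
    and "b \<in> blacks M \<Longrightarrow> h b \<in> HP1"
  using immersed immersed_g immersed_h by (auto simp: immersion_def)

text \<open>
  Every position of lines used at an edge \<open>(w, v)\<close> of \<open>M'\<close>: immersions separate its ends, and \<open>v\<close> is a
  vertex of the black triangles at both ends.
\<close>

lemma edge_lines:
  assumes "e \<in> edges (derived M)"
  shows "f (snd e) \<in> HP1"
    "tail (derived M) e \<in> blacks M" "head (derived M) e \<in> blacks M"
    "g (tail (derived M) e) \<in> HP1" "h (tail (derived M) e) \<in> HP1"
    "g (head (derived M) e) \<in> HP1" "h (head (derived M) e) \<in> HP1"
    "g (tail (derived M) e) \<noteq> g (head (derived M) e)"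
    "h (tail (derived M) e) \<noteq> h (head (derived M) e)"
    "g (tail (derived M) e) \<noteq> h (tail (derived M) e)"
    "g (head (derived M) e) \<noteq> h (head (derived M) e)"
    "g (tail (derived M) e) \<noteq> f (snd e)" "h (tail (derived M) e) \<noteq> f (snd e)"
    "g (head (derived M) e) \<noteq> f (snd e)" "h (head (derived M) e) \<noteq> f (snd e)"
proof -
  obtain w v where e: "e = (w, v)"
    by (cases e)
  obtain d d' where
    d: "d \<in> edges M" "tail M d = v" "tail (derived M) e = black M d" and
    d': "d' \<in> edges M" "head M d' = v" "head (derived M) e = black M d'"
    using derived_edgeE[OF surface] assms unfolding e by metis
  have v: "v \<in> black_vertices M (black M d)" "v \<in> black_vertices M (black M d')"
    using d d' by (force simp: black_vertices_def black_edges_def)+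
  note b = surface_edge[OF surface d(1)] surface_edge[OF surface d'(1)]
  show "f (snd e) \<in> HP1"
    "tail (derived M) e \<in> blacks M" "head (derived M) e \<in> blacks M"
    "g (tail (derived M) e) \<in> HP1" "h (tail (derived M) e) \<in> HP1"
    "g (head (derived M) e) \<in> HP1" "h (head (derived M) e) \<in> HP1"
    "g (tail (derived M) e) \<noteq> h (tail (derived M) e)"
    "g (head (derived M) e) \<noteq> h (head (derived M) e)"
    using b lines d d' g_neq_h by (auto simp: e)
  show "g (tail (derived M) e) \<noteq> g (head (derived M) e)"
    "h (tail (derived M) e) \<noteq> h (head (derived M) e)"
    using immersed_g immersed_h assms by (auto simp: immersion_def)
  show "g (tail (derived M) e) \<noteq> f (snd e)" "h (tail (derived M) e) \<noteq> f (snd e)"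
    "g (head (derived M) e) \<noteq> f (snd e)" "h (head (derived M) e) \<noteq> f (snd e)"
    using darboux_g darboux_h b v d d' unfolding darboux_transform_def by (auto simp: e)
qed

text \<open>
  The black triangles across the edges \<open>e\<^sub>1, e\<^sub>2, e\<^sub>3\<close> of \<open>w\<close> are the vertices of the face \<open>w\<close> of \<open>M'\<close>.
  The edge of \<open>M'\<close> at the vertex where \<open>e\<^sub>i\<close> starts leads from the triangle across \<open>e\<^sub>i\<close> to the one
  across its predecessor, so the boundary of \<open>w\<close> in \<open>M'\<close> is traversed in the order 1, 3, 2. Flatness
  extends a parallel section over the first edge to a parallel section over the whole face.
\<close>

lemma flat_triangle:
  assumes k: "k = g \<or> k = h"
    and w: "w \<in> whites M" "white_edges M w = {e\<^sub>1, e\<^sub>2, e\<^sub>3}"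
    and heads: "head M e\<^sub>1 = tail M e\<^sub>2" "head M e\<^sub>2 = tail M e\<^sub>3" "head M e\<^sub>3 = tail M e\<^sub>1"
    and dist: "distinct [tail M e\<^sub>1, tail M e\<^sub>2, tail M e\<^sub>3]"
    and p: "p\<^sub>1 \<in> k (black M e\<^sub>1)" "p\<^sub>3 \<in> k (black M e\<^sub>3)" "p\<^sub>1 - p\<^sub>3 \<in> f (tail M e\<^sub>1)"
  shows "\<exists>p\<^sub>2\<in>k (black M e\<^sub>2). p\<^sub>3 - p\<^sub>2 \<in> f (tail M e\<^sub>3) \<and> p\<^sub>2 - p\<^sub>1 \<in> f (tail M e\<^sub>2)"
proof -
  let ?D = "derived M"
  have e: "e\<^sub>1 \<in> edges M" "e\<^sub>2 \<in> edges M" "e\<^sub>3 \<in> edges M"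
    "white M e\<^sub>1 = w" "white M e\<^sub>2 = w" "white M e\<^sub>3 = w"
    using w(2) by (auto simp: white_edges_def)
  let ?d\<^sub>1 = "(w, tail M e\<^sub>1)" and ?d\<^sub>2 = "(w, tail M e\<^sub>2)" and ?d\<^sub>3 = "(w, tail M e\<^sub>3)"
  have d: "?d\<^sub>1 \<in> edges ?D" "?d\<^sub>2 \<in> edges ?D" "?d\<^sub>3 \<in> edges ?D"
    "tail ?D ?d\<^sub>1 = black M e\<^sub>1" "tail ?D ?d\<^sub>2 = black M e\<^sub>2" "tail ?D ?d\<^sub>3 = black M e\<^sub>3"
    "head ?D ?d\<^sub>1 = black M e\<^sub>3" "head ?D ?d\<^sub>2 = black M e\<^sub>1" "head ?D ?d\<^sub>3 = black M e\<^sub>2"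
    using derived_edge_tail[OF surface] derived_edge_head[OF surface] e heads by metis+
  have "black_edges ?D w = {?d\<^sub>1, ?d\<^sub>3, ?d\<^sub>2}"
    using w heads by (auto simp: black_edges_def derived_edges_iff white_vertices_def)
  then have cyc: "boundary_cycle ?D (black_edges ?D w) [?d\<^sub>1, ?d\<^sub>3, ?d\<^sub>2]"
    using dist d by (auto simp: boundary_cycle_def less_Suc_eq)
  have "trivial_holonomy M f k (black_edges ?D w)"
    using k w(1) darboux_g darboux_h by (auto simp: darboux_transform_def)
  then have "\<forall>\<psi>\<in>k (tail ?D ?d\<^sub>1). fold (edge_transport M f k) [?d\<^sub>1, ?d\<^sub>3, ?d\<^sub>2] \<psi> = \<psi>"
    using cyc unfolding trivial_holonomy_def
    by (elim allE[of _ "[?d\<^sub>1, ?d\<^sub>3, ?d\<^sub>2]"]) simp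
  then have hol: "fold (edge_transport M f k) [?d\<^sub>1, ?d\<^sub>3, ?d\<^sub>2] p\<^sub>1 = p\<^sub>1"
    using p(1) d(4) by metis
  let ?T = "\<lambda>d. line_transport (f (snd d)) (k (head ?D d))"
  have hp: "f (snd x) \<in> HP1 \<and> k (head ?D x) \<in> HP1 \<and> k (head ?D x) \<noteq> f (snd x)"
    if "x \<in> edges ?D" for x
    using k edge_lines(1,6,7,14,15)[OF that] by (elim disjE) simp_all
  have "?T ?d\<^sub>1 p\<^sub>1 = p\<^sub>3"
    using hp[OF d(1)] p d by (intro line_transport_unique) auto
  moreover define p\<^sub>2 where "p\<^sub>2 = ?T ?d\<^sub>3 p\<^sub>3"
  ultimately have "?T ?d\<^sub>2 p\<^sub>2 = p\<^sub>1"
    using hol by (simp add: edge_transport_def)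
  moreover have "p\<^sub>2 - ?T ?d\<^sub>2 p\<^sub>2 \<in> f (tail M e\<^sub>2)"
    using hp[OF d(2)] line_transport(2) by auto
  moreover have "p\<^sub>2 \<in> k (black M e\<^sub>2)" "p\<^sub>3 - p\<^sub>2 \<in> f (tail M e\<^sub>3)"
    using line_transport[of "f (tail M e\<^sub>3)" "k (black M e\<^sub>2)"] hp[OF d(3)] d by (auto simp: p\<^sub>2_def)
  ultimately show ?thesis by auto
qed

text \<open>
  Extend both components of \<open>x\<close> over the face. Their sum has the same value \<open>x\<close> at both
  ends of the edge \<open>(w, tail M e\<^sub>1)\<close> of \<open>M'\<close>, so its changes along the other two edges are opposite.
  These changes lie in \<open>f\<close> of two different vertices of \<open>w\<close>, and \<open>f\<close> is immersed; so both vanish.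
\<close>

lemma corner_line_subset_previous:
  assumes w: "w \<in> whites M" "white_edges M w = {e\<^sub>1, e\<^sub>2, e\<^sub>3}"
    and heads: "head M e\<^sub>1 = tail M e\<^sub>2" "head M e\<^sub>2 = tail M e\<^sub>3" "head M e\<^sub>3 = tail M e\<^sub>1"
    and dist: "distinct [tail M e\<^sub>1, tail M e\<^sub>2, tail M e\<^sub>3]"
  shows "corner_line (w, tail M e\<^sub>1) \<subseteq> corner_line (w, tail M e\<^sub>3)"
proof
  let ?D = "derived M"
  have e: "e\<^sub>1 \<in> edges M" "e\<^sub>2 \<in> edges M" "e\<^sub>3 \<in> edges M"
    "white M e\<^sub>1 = w" "white M e\<^sub>2 = w" "white M e\<^sub>3 = w"
    using w(2) by (auto simp: white_edges_def)
  have d: "tail ?D (w, tail M e\<^sub>1) = black M e\<^sub>1" "tail ?D (w, tail M e\<^sub>3) = black M e\<^sub>3"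
    "head ?D (w, tail M e\<^sub>1) = black M e\<^sub>3" "head ?D (w, tail M e\<^sub>3) = black M e\<^sub>2"
    using derived_edge_tail(2)[OF surface] derived_edge_head(2)[OF surface] e heads by metis+
  have f_HP1: "f (tail M e\<^sub>2) \<in> HP1" "f (tail M e\<^sub>3) \<in> HP1"
    using lines(1) surface_edge[OF surface] e by auto
  have f_neq: "f (tail M e\<^sub>2) \<noteq> f (tail M e\<^sub>3)"
    using immersed e heads by (metis immersion_def)
  fix x assume "x \<in> corner_line (w, tail M e\<^sub>1)"
  then obtain p\<^sub>1 q\<^sub>1 p\<^sub>3 q\<^sub>3 where
    pq: "p\<^sub>1 \<in> g (black M e\<^sub>1)" "q\<^sub>1 \<in> h (black M e\<^sub>1)" "p\<^sub>3 \<in> g (black M e\<^sub>3)" "q\<^sub>3 \<in> h (black M e\<^sub>3)"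
      "x = p\<^sub>1 + q\<^sub>1" "x = p\<^sub>3 + q\<^sub>3" "p\<^sub>1 - p\<^sub>3 \<in> f (tail M e\<^sub>1)" "q\<^sub>1 - q\<^sub>3 \<in> f (tail M e\<^sub>1)"
    unfolding corner_line_def common_line_def by (auto simp: d)
  obtain p\<^sub>2 where p2: "p\<^sub>2 \<in> g (black M e\<^sub>2)" "p\<^sub>3 - p\<^sub>2 \<in> f (tail M e\<^sub>3)" "p\<^sub>2 - p\<^sub>1 \<in> f (tail M e\<^sub>2)"
    using flat_triangle[of g, OF _ assms pq(1,3,7)] by auto
  obtain q\<^sub>2 where q2: "q\<^sub>2 \<in> h (black M e\<^sub>2)" "q\<^sub>3 - q\<^sub>2 \<in> f (tail M e\<^sub>3)" "q\<^sub>2 - q\<^sub>1 \<in> f (tail M e\<^sub>2)"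
    using flat_triangle[of h, OF _ assms pq(2,4,8)] by auto
  have "(p\<^sub>3 - p\<^sub>2) + (q\<^sub>3 - q\<^sub>2) = - ((p\<^sub>2 - p\<^sub>1) + (q\<^sub>2 - q\<^sub>1))"
    using pq(5,6) by (simp add: algebra_simps)
  moreover have "(p\<^sub>3 - p\<^sub>2) + (q\<^sub>3 - q\<^sub>2) \<in> f (tail M e\<^sub>3)"
    using HP1_add[OF f_HP1(2)] p2 q2 by blast
  moreover have "- ((p\<^sub>2 - p\<^sub>1) + (q\<^sub>2 - q\<^sub>1)) \<in> f (tail M e\<^sub>2)"
    using HP1_uminus[OF f_HP1(1)] HP1_add[OF f_HP1(1)] p2 q2 by blast
  ultimately have "(p\<^sub>3 - p\<^sub>2) + (q\<^sub>3 - q\<^sub>2) = 0"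
    using HP1_disjoint[OF f_HP1 f_neq] by metis
  then have "x = p\<^sub>2 + q\<^sub>2"
    using pq(6) by (simp add: algebra_simps)
  then show "x \<in> corner_line (w, tail M e\<^sub>3)"
    using pq(3,4,6) p2(1,2) q2(1,2) unfolding corner_line_def common_line_def d snd_conv by blast
qed

text \<open>
  Going once around the triangle, the inclusions between consecutive corners become equalities.
\<close>

lemma permuted_eq_corner_line:
  assumes "(w, v) \<in> edges (derived M)"
  shows "permuted w = corner_line (w, v)"
proof -
  have w: "w \<in> whites M" and v: "v \<in> white_vertices M w"
    using assms by (auto simp: derived_edges_iff)
  obtain e\<^sub>1 e\<^sub>2 e\<^sub>3 where S: "white_edges M w = {e\<^sub>1, e\<^sub>2, e\<^sub>3}"
    "head M e\<^sub>1 = tail M e\<^sub>2" "head M e\<^sub>2 = tail M e\<^sub>3" "head M e\<^sub>3 = tail M e\<^sub>1"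
    "distinct [tail M e\<^sub>1, tail M e\<^sub>2, tail M e\<^sub>3]"
    using triangleE[OF surface_white_triangle[OF surface w]] by metis
  have "corner_line (w, tail M e\<^sub>1) \<subseteq> corner_line (w, tail M e\<^sub>3)"
    using corner_line_subset_previous[of w e\<^sub>1 e\<^sub>2 e\<^sub>3] S w by auto
  moreover have "corner_line (w, tail M e\<^sub>3) \<subseteq> corner_line (w, tail M e\<^sub>2)"
    using corner_line_subset_previous[of w e\<^sub>3 e\<^sub>1 e\<^sub>2] S w
    by (simp add: insert_commute eq_commute)
  moreover have "corner_line (w, tail M e\<^sub>2) \<subseteq> corner_line (w, tail M e\<^sub>1)"
    using corner_line_subset_previous[of w e\<^sub>2 e\<^sub>3 e\<^sub>1] S w
    by (simp add: insert_commute eq_commute)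
  moreover have "white_vertices M w = {tail M e\<^sub>1, tail M e\<^sub>2, tail M e\<^sub>3}"
    using S by (auto simp: white_vertices_def)
  ultimately show ?thesis
    using v unfolding permuted_def by auto
qed

lemma corner_line_HP1: "e \<in> edges (derived M) \<Longrightarrow> corner_line e \<in> HP1"
  unfolding corner_line_def using edge_lines[of e] by (intro common_line_HP1) auto

lemma corner_line_Int_tail:
  assumes "e \<in> edges (derived M)" "x \<in> corner_line e" "x \<in> g (tail (derived M) e)"
  shows "x = 0"
  using assms(2,3) edge_lines[OF assms(1)] unfolding corner_line_def
  by (intro common_line_Int_end[of _ "g (tail (derived M) e)" _ "g (head (derived M) e)"])
     (assumption | metis)+

lemma corner_line_Int_head:
  assumes "e \<in> edges (derived M)" "x \<in> corner_line e" "x \<in> g (head (derived M) e)"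
  shows "x = 0"
proof -
  note l = edge_lines[OF assms(1)]
  have x: "x \<in> common_line (f (snd e)) (g (head (derived M) e)) (h (head (derived M) e))
      (g (tail (derived M) e)) (h (tail (derived M) e))"
    using assms(2) common_line_swap[OF l(1)] unfolding corner_line_def by metis
  show ?thesis
    using l by (intro common_line_Int_end[OF _ _ _ _ _ _ _ x assms(3)]) (assumption | metis)+
qed

lemma white_cornerE:
  assumes "w \<in> whites M"
  obtains v where "(w, v) \<in> edges (derived M)"
  using triangleE[OF surface_white_triangle[OF surface assms]] assms
  by (metis derived_edges_iff imageI insertI1 UnI1 white_vertices_def)

lemma permuted_HP1: "w \<in> whites M \<Longrightarrow> permuted w \<in> HP1"
  by (metis white_cornerE permuted_eq_corner_line corner_line_HP1)

lemma permuted_neq: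
  assumes "(w, v) \<in> edges (derived M)"
  shows "permuted w \<noteq> g (tail (derived M) (w, v))" "permuted w \<noteq> g (head (derived M) (w, v))"
  using corner_line_Int_tail[OF assms] corner_line_Int_head[OF assms]
    HP1_nonzero[OF corner_line_HP1[OF assms]] permuted_eq_corner_line[OF assms] by metis+

text \<open>
  The edge \<open>(v, b)\<close> of \<open>M''\<close> joins the two white triangles whose corners at \<open>v\<close> are the edges of \<open>M'\<close>
  starting and ending at \<open>b\<close>.
\<close>

lemma permuted_step:
  assumes "(v, b) \<in> edges (derived (derived M))"
  defines "w \<equiv> tail (derived (derived M)) (v, b)" and "w' \<equiv> head (derived (derived M)) (v, b)"
    and "T \<equiv> edge_transport (derived M) g permuted (v, b)"
  shows "(w, v) \<in> edges (derived M)" "tail (derived M) (w, v) = b"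
    and "(w', v) \<in> edges (derived M)" "head (derived M) (w', v) = b"
    and "T x \<in> permuted w'" "x - T x \<in> g b"
proof -
  show *: "(w, v) \<in> edges (derived M)" "tail (derived M) (w, v) = b"
    "(w', v) \<in> edges (derived M)" "head (derived M) (w', v) = b"
    using derived_derived_edgeE[OF surface assms(1)] unfolding w_def w'_def by metis+
  have "g b \<in> HP1" "permuted w' \<in> HP1" "permuted w' \<noteq> g b"
    using edge_lines(6)[OF *(3)] corner_line_HP1[OF *(3)] permuted_eq_corner_line[OF *(3)]
      permuted_neq(2)[OF *(3)] *(4) by auto
  from line_transport[OF this] show "T x \<in> permuted w'" "x - T x \<in> g b"
    unfolding T_def edge_transport_def w'_def by simp_all
qed

text \<open>
  The vector \<open>y\<close> only represents a class modulo \<open>f v\<close>. It is the class of the \<open>h\<close>-component of \<open>x\<close>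
  at both ends of the edge \<open>(w, v)\<close> of \<open>M'\<close>; on the new line at \<open>w\<close> the two classes agree.
\<close>

definition corner_component :: "'v \<Rightarrow> quat2 \<Rightarrow> 'w \<Rightarrow> quat2 \<Rightarrow> bool" where
  "corner_component v y w x \<longleftrightarrow>
     (\<exists>p\<^sub>1\<in>g (tail (derived M) (w, v)). \<exists>q\<^sub>1\<in>h (tail (derived M) (w, v)).
      \<exists>p\<^sub>2\<in>g (head (derived M) (w, v)). \<exists>q\<^sub>2\<in>h (head (derived M) (w, v)).
        x = p\<^sub>1 + q\<^sub>1 \<and> x = p\<^sub>2 + q\<^sub>2 \<and> q\<^sub>1 - y \<in> f v \<and> q\<^sub>2 - y \<in> f v)"

lemma corner_component_exists:
  assumes "(w, v) \<in> edges (derived M)" "x \<in> permuted w"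
  shows "\<exists>y. corner_component v y w x"
proof -
  have "f v \<in> HP1"
    using edge_lines(1)[OF assms(1)] by simp
  then have "q - q \<in> f v" for q
    using HP1_zero by simp
  moreover obtain p\<^sub>1 q\<^sub>1 p\<^sub>2 q\<^sub>2 where
    "p\<^sub>1 \<in> g (tail (derived M) (w, v))" "q\<^sub>1 \<in> h (tail (derived M) (w, v))"
    "p\<^sub>2 \<in> g (head (derived M) (w, v))" "q\<^sub>2 \<in> h (head (derived M) (w, v))"
    "x = p\<^sub>1 + q\<^sub>1" "x = p\<^sub>2 + q\<^sub>2" "p\<^sub>1 - p\<^sub>2 \<in> f v" "q\<^sub>1 - q\<^sub>2 \<in> f v"
    using assms(2) unfolding permuted_eq_corner_line[OF assms(1)] corner_line_def common_line_def
    by auto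
  ultimately have "corner_component v q\<^sub>2 w x"
    unfolding corner_component_def by blast
  then show ?thesis ..
qed

text \<open>
  Equal classes modulo \<open>f v\<close> have equal representatives in the \<open>h\<close>-lines at both ends. Then the
  difference of the vectors lies in the two \<open>g\<close>-lines, which are distinct.
\<close>

lemma corner_component_unique:
  assumes e: "(w, v) \<in> edges (derived M)"
    and "corner_component v y w x" "corner_component v y w x'"
  shows "x = x'"
proof -
  let ?b = "tail (derived M) (w, v)" and ?b' = "head (derived M) (w, v)"
  note l = edge_lines[OF e, simplified]
  obtain p\<^sub>1 q\<^sub>1 p\<^sub>2 q\<^sub>2 where x:
    "p\<^sub>1 \<in> g ?b" "q\<^sub>1 \<in> h ?b" "p\<^sub>2 \<in> g ?b'" "q\<^sub>2 \<in> h ?b'"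
    "x = p\<^sub>1 + q\<^sub>1" "x = p\<^sub>2 + q\<^sub>2" "q\<^sub>1 - y \<in> f v" "q\<^sub>2 - y \<in> f v"
    using assms(2) unfolding corner_component_def by blast
  obtain p\<^sub>1' q\<^sub>1' p\<^sub>2' q\<^sub>2' where x':
    "p\<^sub>1' \<in> g ?b" "q\<^sub>1' \<in> h ?b" "p\<^sub>2' \<in> g ?b'" "q\<^sub>2' \<in> h ?b'"
    "x' = p\<^sub>1' + q\<^sub>1'" "x' = p\<^sub>2' + q\<^sub>2'" "q\<^sub>1' - y \<in> f v" "q\<^sub>2' - y \<in> f v"
    using assms(3) unfolding corner_component_def by blast
  have "q\<^sub>1 - q\<^sub>1' \<in> f v" "q\<^sub>2 - q\<^sub>2' \<in> f v"
    using HP1_diff_trans[OF l(1)] HP1_diff_commute[OF l(1)] x x' by blast+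
  moreover have "q\<^sub>1 - q\<^sub>1' \<in> h ?b" "q\<^sub>2 - q\<^sub>2' \<in> h ?b'"
    using HP1_diff[OF l(5)] HP1_diff[OF l(7)] x x' by blast+
  ultimately have "q\<^sub>1 - q\<^sub>1' = 0" "q\<^sub>2 - q\<^sub>2' = 0"
    using HP1_disjoint l by metis+
  moreover have "x - x' = (p\<^sub>1 - p\<^sub>1') + (q\<^sub>1 - q\<^sub>1')"
    unfolding x(5) x'(5) by (simp add: algebra_simps)
  moreover have "x - x' = (p\<^sub>2 - p\<^sub>2') + (q\<^sub>2 - q\<^sub>2')"
    unfolding x(6) x'(6) by (simp add: algebra_simps)
  ultimately have "x - x' = p\<^sub>1 - p\<^sub>1'" "x - x' = p\<^sub>2 - p\<^sub>2'"
    by simp_all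
  then have "x - x' \<in> g ?b" "x - x' \<in> g ?b'"
    using HP1_diff[OF l(4)] HP1_diff[OF l(6)] x x' by metis+
  then show ?thesis
    using HP1_disjoint[OF l(4,6,8)] by (metis eq_iff_diff_eq_0)
qed

text \<open>
  The transported vector differs from \<open>x\<close> by an element of \<open>g b\<close> and has the same component \<open>q\<close> in
  \<open>h b\<close>. The black triangle \<open>b\<close> is the head of the edge of \<open>M'\<close> at the white triangle reached. As the
  transported vector lies in the new line there, its \<open>h\<close>-component at the tail of that edge is
  congruent to \<open>q\<close> modulo \<open>f v\<close>.
\<close>

lemma corner_component_step:
  assumes "(v, b) \<in> edges (derived (derived M))"
    and x: "corner_component v y (tail (derived (derived M)) (v, b)) x"
  shows "corner_component v y (head (derived (derived M)) (v, b))
           (edge_transport (derived M) g permuted (v, b) x)"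
proof -
  define w where "w = tail (derived (derived M)) (v, b)"
  define w' where "w' = head (derived (derived M)) (v, b)"
  define x' where "x' = edge_transport (derived M) g permuted (v, b) x"
  note step = permuted_step[OF assms(1), folded w_def w'_def]
  have x': "x' \<in> permuted w'" "x - x' \<in> g b"
    using step(5,6) by (simp_all add: x'_def)
  note l = edge_lines[OF step(3), simplified]
  have b: "g b \<in> HP1" "h b \<in> HP1" "g b \<noteq> h b"
    using l(6,7,11) step(4) by simp_all
  obtain p q where pq: "p \<in> g b" "q \<in> h b" "x = p + q" "q - y \<in> f v"
    using x step(2) unfolding corner_component_def by (metis w_def)
  obtain p\<^sub>1 q\<^sub>1 p\<^sub>2 q\<^sub>2 where pq':
    "p\<^sub>1 \<in> g (tail (derived M) (w', v))" "q\<^sub>1 \<in> h (tail (derived M) (w', v))"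
    "p\<^sub>2 \<in> g b" "q\<^sub>2 \<in> h b"
    "x' = p\<^sub>1 + q\<^sub>1" "x' = p\<^sub>2 + q\<^sub>2" "p\<^sub>1 - p\<^sub>2 \<in> f v" "q\<^sub>1 - q\<^sub>2 \<in> f v"
    using x'(1) step(4) unfolding permuted_eq_corner_line[OF step(3)] corner_line_def common_line_def
    by auto
  have "p + q = (p\<^sub>2 + (x - x')) + q\<^sub>2"
    using pq(3) pq'(6) by simp
  then have "q = q\<^sub>2"
    using HP1_decompose_unique[OF b pq(1,2) _ pq'(4)] HP1_add[OF b(1) pq'(3) x'(2)] by blast
  moreover from this have "q\<^sub>1 - y \<in> f v"
    using HP1_diff_trans[OF l(1)] pq'(8) pq(4) by blast
  ultimately show ?thesis
    using pq pq' step(4) unfolding corner_component_def w'_def[symmetric] x'_def[symmetric] by blast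
qed

lemma trivial_holonomy_black:
  "trivial_holonomy (derived M) g permuted (black_edges (derived (derived M)) v)"
  unfolding trivial_holonomy_def
proof (intro allI impI ballI)
  fix es x
  let ?N = "derived (derived M)" and ?T = "edge_transport (derived M) g permuted"
  assume cyc: "boundary_cycle ?N (black_edges ?N v) es" and x: "x \<in> permuted (tail ?N (hd es))"
  have S: "e \<in> edges ?N \<and> fst e = v" if "e \<in> black_edges ?N v" for e
    using that by (simp add: black_edges_def)
  have "hd es \<in> black_edges ?N v"
    using cyc by (auto simp: boundary_cycle_def)
  then have e: "(tail ?N (hd es), v) \<in> edges (derived M)"
    using S permuted_step(1) by (metis prod.collapse)
  obtain y where y: "corner_component v y (tail ?N (hd es)) x"
    using corner_component_exists[OF e x] ..
  have "corner_component v y (tail ?N (hd es)) (fold ?T es x)"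
  proof (rule holonomy_invariant[OF cyc, where I = "corner_component v y"])
    fix d z assume "d \<in> black_edges ?N v" "corner_component v y (tail ?N d) z"
    then show "corner_component v y (head ?N d) (?T d z)"
      using S[of d] corner_component_step[of v "snd d" y z] by (cases d) auto
  qed (rule y)
  with y show "fold ?T es x = x"
    using corner_component_unique[OF e] by blast
qed

text \<open>
  Every transport around \<open>b\<close> divides out the same line \<open>g b\<close>, so the class modulo \<open>g b\<close> is invariant.
\<close>

lemma trivial_holonomy_white:
  "trivial_holonomy (derived M) g permuted (white_edges (derived (derived M)) b)"
  unfolding trivial_holonomy_def
proof (intro allI impI ballI)
  fix es x
  let ?N = "derived (derived M)" and ?T = "edge_transport (derived M) g permuted"
  assume cyc: "boundary_cycle ?N (white_edges ?N b) es" and x: "x \<in> permuted (tail ?N (hd es))"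
  have S: "e \<in> edges ?N \<and> snd e = b" if "e \<in> white_edges ?N b" for e
    using that by (simp add: white_edges_def)
  have "hd es \<in> white_edges ?N b"
    using cyc by (auto simp: boundary_cycle_def)
  then obtain v where v: "(v, b) \<in> edges ?N" "hd es = (v, b)"
    using S by (metis prod.collapse)
  note step = permuted_step[OF v(1), folded v(2)]
  have l: "g b \<in> HP1" "permuted (tail ?N (hd es)) \<in> HP1" "permuted (tail ?N (hd es)) \<noteq> g b"
    using edge_lines(4)[OF step(1)] corner_line_HP1[OF step(1)] permuted_eq_corner_line[OF step(1)]
      permuted_neq(1)[OF step(1)] step(2) by auto
  have "fold ?T es x \<in> permuted (tail ?N (hd es)) \<and> x - fold ?T es x \<in> g b"
  proof (rule holonomy_invariant[OF cyc, where I = "\<lambda>w z. z \<in> permuted w \<and> x - z \<in> g b"])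
    fix d z assume "d \<in> white_edges ?N b" "z \<in> permuted (tail ?N d) \<and> x - z \<in> g b"
    then show "?T d z \<in> permuted (head ?N d) \<and> x - ?T d z \<in> g b"
      using S[of d] permuted_step(5,6)[of "fst d" b z] HP1_diff_trans[OF l(1), of x z "?T d z"]
      by (cases d) auto
  next
    show "x \<in> permuted (tail ?N (hd es)) \<and> x - x \<in> g b"
      using x HP1_zero[OF l(1)] by simp
  qed
  then show "fold ?T es x = x"
    using HP1_disjoint[OF l(2,1,3)] HP1_diff[OF l(2) x] by (metis eq_iff_diff_eq_0)
qed

lemma darboux_transform_permuted: "darboux_transform (derived M) g permuted"
  unfolding darboux_transform_def
proof (intro conjI ballI)
  show "permuted ` vertices (derived (derived M)) \<subseteq> HP1"
    using permuted_HP1 by auto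
next
  fix w b assume "b \<in> black_vertices (derived M) w"
  then obtain v where "(w, v) \<in> edges (derived M)"
    "b = tail (derived M) (w, v) \<or> b = head (derived M) (w, v)"
    by (auto simp: black_vertices_def black_edges_def)
  then show "permuted w \<noteq> g b"
    using permuted_neq by blast
qed (rule trivial_holonomy_black trivial_holonomy_white)+

end

theorem theorem4p21:
  fixes M :: "('v, 'b, 'w, 'e) bicolored"
    and f :: "'v \<Rightarrow> quat2 set"
    and f_sharp f_flat :: "'b \<Rightarrow> quat2 set"
  assumes "discrete_surface M"
    and "regular_combinatorics M"
    and "immersion M f"
    and "darboux_transform M f f_sharp"
    and "darboux_transform M f f_flat"
    and "immersion (derived M) f_sharp"
    and "immersion (derived M) f_flat"
    and "\<And>b. b \<in> vertices (derived M) \<Longrightarrow> f_sharp b \<noteq> f_flat b"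
  shows "\<exists>f_tilde :: 'w \<Rightarrow> quat2 set.
           darboux_transform (derived M) f_sharp f_tilde \<and>
           darboux_transform (derived M) f_flat f_tilde"
proof -
  interpret pair: darboux_pair M f f_sharp f_flat
    using assms by (intro darboux_pair.intro) auto
  interpret swapped: darboux_pair M f f_flat f_sharp
    using assms by (intro darboux_pair.intro) (auto dest: sym)
  have "swapped.permuted = pair.permuted"
    unfolding swapped.permuted_def pair.permuted_def
      swapped.corner_line_def pair.corner_line_def by (subst common_line_commute) (rule refl)
  then show ?thesis
    using pair.darboux_transform_permuted swapped.darboux_transform_permuted by metis
qed

end
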